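(* Let $\hat x\in[0,1]^n$, and let $F(\hat x)=\sum_{\ell=1}^{k}\hat\lambda_\ell\hat u_\ell\hat u_\ell^\top$ be a spectral decomposition of $F(\hat x)$, with $\hat\lambda_1\ge\hat\lambda_2\ge\cdots\ge\hat\lambda_k$ and $\hat u_1,\dots,\hat u_k$ orthonormal. Let $\hat\iota:=\iota(\hat\lambda)$ be the integer $\iota$ associated with $\hat\lambda=(\hat\lambda_1,\dots,\hat\lambda_k)$. If $$\frac{1}{s-\hat\iota}\sum_{\ell=\hat\iota+1}^{k}\hat\lambda_\ell>\hat\lambda_{\hat\iota+1},$$ then, for $j=1,2,\dots,n$, $$\frac{\partial}{\partial x_j}\Gamma_s(F(\hat x))=\sum_{\ell=1}^{\hat\iota}\frac{1}{\hat\lambda_\ell}(F_{j\cdot}\hat u_\ell)^2+\sum_{\ell=\hat\iota+1}^{k}\frac{s-\hat\iota}{\sum_{i=\hat\iota+1}^{k}\hat\lambda_i}(F_{j\cdot}\hat u_\ell)^2 .$$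
   Context: Let $n>1$, $0<s<n$ be integers, let $C$ be a real symmetric positive semidefinite $n\times n$ matrix of rank $r\ge s$, and let $C=FF^\top$ with $F\in\mathbb{R}^{n\times k}$, $r\le k\le n$. $F_{j\cdot}$ denotes the $j$-th row of $F$. For $x\in[0,1]^n$ let $F(x):=\sum_{j=1}^{n}x_jF_{j\cdot}^\top F_{j\cdot}=F^\top\operatorname{Diag}(x)F$, where $\operatorname{Diag}(x)$ is the diagonal matrix with diagonal $x$. For $\lambda\in\mathbb{R}^k_+$ with $\lambda_1\ge\cdots\ge\lambda_k$ and $0<s\le k$, there is a unique integer $\iota=\iota(\lambda)$ with $0\le\iota<s$ such that $$\lambda_\iota>\frac{1}{s-\iota}\sum_{\ell=\iota+1}^{k}\lambda_\ell\ge\lambda_{\iota+1},$$ with the convention $\lambda_0=+\infty$ (a known lemma of Nikolov). With this $\iota$, define $$\phi_s(\lambda):=\sum_{\ell=1}^{\iota}\log\lambda_\ell+(s-\iota)\log\Big(\frac{1}{s-\iota}\sum_{\ell=\iota+1}^{k}\lambda_\ell\Big).$$ For a symmetric positive semidefinite $X$ of order $k$, with eigenvalues $\lambda_1(X)\ge\cdots\ge\lambda_k(X)$, define $\Gamma_s(X):=\phi_s(\lambda_1(X),\dots,\lambda_k(X))$. The partial derivatives are those of the function $x\mapsto\Gamma_s(F(x))$ on $[0,1]^n$ at $\hat x$ (one-sided in $x_j$ if $\hat x_j\in\{0,1\}$). *)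

theory Defs
  imports "HOL-Analysis.Analysis" "HOL-Computational_Algebra.Polynomial"
begin

definition pos_semidef :: "real ^ 'n ^ 'n \<Rightarrow> bool" where
  "pos_semidef A \<longleftrightarrow> transpose A = A \<and> (\<forall>v. 0 \<le> v \<bullet> (A *v v))"

definition outer :: "real ^ 'm \<Rightarrow> real ^ 'n \<Rightarrow> real ^ 'n ^ 'm" where
  "outer u v = (\<chi> i j. u $ i * v $ j)"

definition diag_mat :: "real ^ 'n \<Rightarrow> real ^ 'n ^ 'n" where
  "diag_mat x = (\<chi> i j. if i = j then x $ i else 0)"

definition Fmap :: "real ^ 'k ^ 'n \<Rightarrow> real ^ 'n \<Rightarrow> real ^ 'k ^ 'k" where
  "Fmap F x = (\<Sum>j\<in>UNIV. (x $ j) *\<^sub>R outer (row j F) (row j F))"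

lemma Fmap_eq_congruence: "Fmap F x = transpose F ** diag_mat x ** F"
  by (simp add: vec_eq_iff Fmap_def outer_def diag_mat_def row_def transpose_def
      matrix_matrix_mult_def if_distrib [of "\<lambda>t. _ * t"] sum.delta' mult.commute mult.left_commute
      cong: if_cong)

definition char_polynomial :: "real ^ 'k ^ 'k \<Rightarrow> real poly" where
  "char_polynomial X = det (\<chi> i j. (if i = j then [:0, 1:] else 0) - [:X $ i $ j:])"

text \<open>
  \<open>eigval X l\<close>, for \<open>1 \<le> l \<le> CARD('k)\<close>, is the \<open>l\<close>-th largest eigenvalue of a symmetric matrix
  \<open>X\<close>: the real roots of the characteristic polynomial, repeated by multiplicity, are listed in
  decreasing order, with indices starting at 1.
\<close>

definition eigval :: "real ^ 'k ^ 'k \<Rightarrow> nat \<Rightarrow> real" where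
  "eigval X l = rev (sorted_list_of_multiset (proots (char_polynomial X))) ! (l - 1)"

text \<open>
  A vector of \<open>\<real>\<^sup>k\<close> with \<open>k\<close> a number is a function on \<open>nat\<close>, of which only the values at
  \<open>1, \<dots>, k\<close> are used.
\<close>

definition tail_avg :: "nat \<Rightarrow> nat \<Rightarrow> (nat \<Rightarrow> real) \<Rightarrow> nat \<Rightarrow> real" where
  "tail_avg k s lam i = (\<Sum>l = i + 1..k. lam l) / (real s - real i)"

text \<open>The disjunct \<open>i = 0\<close> encodes the convention that the zeroth entry is infinite.\<close>

definition is_iota :: "nat \<Rightarrow> nat \<Rightarrow> (nat \<Rightarrow> real) \<Rightarrow> nat \<Rightarrow> bool" where
  "is_iota k s lam i \<longleftrightarrow>
     i < s \<and> (i = 0 \<or> lam i > tail_avg k s lam i) \<and> tail_avg k s lam i \<ge> lam (i + 1)"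

definition iota :: "nat \<Rightarrow> nat \<Rightarrow> (nat \<Rightarrow> real) \<Rightarrow> nat" where
  "iota k s lam = (THE i. is_iota k s lam i)"

lemma is_iota_ex1:
  assumes s: "0 < s" "s \<le> k"
    and nonneg: "\<And>l. 1 \<le> l \<Longrightarrow> l \<le> k \<Longrightarrow> 0 \<le> lam l"
    and decr: "\<And>l m. 1 \<le> l \<Longrightarrow> l \<le> m \<Longrightarrow> m \<le> k \<Longrightarrow> lam m \<le> lam l"
  shows "\<exists>!i. is_iota k s lam i"
proof -
  define S where "S i = (\<Sum>l = i + 1..k. lam l)" for i
  define P where "P i \<longleftrightarrow> (real s - real i) * lam (i + 1) \<le> S i" for i
  have S_step: "S i = lam (i + 1) + S (i + 1)" if "i < k" for i
    using that by (simp add: S_def sum.atLeast_Suc_atMost)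
  have P_iff: "P i \<longleftrightarrow> lam (i + 1) \<le> tail_avg k s lam i" if "i < s" for i
    using that by (simp add: P_def S_def tail_avg_def pos_le_divide_eq mult.commute)
  have notP_iff: "\<not> P i \<longleftrightarrow> tail_avg k s lam (i + 1) < lam (i + 1)" if "i + 1 < s" for i
    using that s S_step [of i]
    by (simp add: P_def S_def tail_avg_def pos_divide_less_eq algebra_simps not_le)
  have notP_down: "\<not> P i" if "\<not> P (i + 1)" "i + 1 < s" for i
  proof -
    have "(real s - real i - 1) * lam (i + 2) \<le> (real s - real i - 1) * lam (i + 1)"
      by (rule mult_left_mono) (use decr [of "i + 1" "i + 2"] that s in auto)
    moreover have "S (i + 1) < (real s - real i - 1) * lam (i + 2)"
      using that by (simp add: P_def algebra_simps)
    ultimately show ?thesis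
      using S_step [of i] that s by (simp add: P_def algebra_simps)
  qed
  have notP_le: "\<not> P i" if "i \<le> j" "\<not> P j" "j < s" for i j
    using that by (induction rule: inc_induct) (use notP_down in auto)
  have "S s \<ge> 0"
    unfolding S_def by (rule sum_nonneg) (use nonneg in auto)
  then have "P (s - 1)"
    using S_step [of "s - 1"] s by (simp add: P_def of_nat_diff)
  define i0 where "i0 = (LEAST i. P i)"
  have P0: "P i0" and i0_less: "i0 < s"
    using LeastI [of P, OF \<open>P (s - 1)\<close>] Least_le [of P, OF \<open>P (s - 1)\<close>] s
    by (auto simp: i0_def)
  have before: "\<not> P i" if "i < i0" for i
    using not_less_Least that by (simp add: i0_def)
  show ?thesis
  proof (rule ex1I)
    show "is_iota k s lam i0"
      using P0 i0_less P_iff [of i0] before [of "i0 - 1"] notP_iff [of "i0 - 1"]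
      by (cases "i0 = 0") (auto simp: is_iota_def)
  next
    fix i assume i: "is_iota k s lam i"
    then have "i < s" "P i"
      using P_iff by (auto simp: is_iota_def)
    moreover have False if "i0 < i"
    proof -
      have "\<not> P (i - 1)"
        using i notP_iff [of "i - 1"] that by (auto simp: is_iota_def)
      then show False
        using notP_le [of i0 "i - 1"] P0 that \<open>i < s\<close> by fastforce
    qed
    ultimately show "i = i0"
      using before [of i] by (meson linorder_neqE_nat)
  qed
qed

text \<open>
  On vectors with fewer than \<open>s\<close> positive entries the value of \<open>\<phi>\<^sub>s\<close> is \<open>-\<infinity>\<close>; there \<open>phi\<close> returns a
  real number instead, by the library convention \<open>ln 0 = 0\<close>.
\<close>

definition phi :: "nat \<Rightarrow> nat \<Rightarrow> (nat \<Rightarrow> real) \<Rightarrow> real" where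
  "phi k s lam = (let i = iota k s lam in
     (\<Sum>l = 1..i. ln (lam l)) + (real s - real i) * ln (tail_avg k s lam i))"

definition Gam :: "nat \<Rightarrow> real ^ 'k ^ 'k \<Rightarrow> real" where
  "Gam s X = phi CARD('k) s (eigval X)"

end

theory Submission
  imports Defs
begin

text \<open>
  Moving \<open>x\<^sub>j\<close> by \<open>\<tau>\<close> adds \<open>\<tau> v v\<^sup>T\<close> to \<open>F(x)\<close>, where \<open>v\<close> is the \<open>j\<close>-th row of \<open>F\<close>. In an
  eigenbasis the matrix is then a diagonal one plus a rank one term, so the characteristic polynomial
  is affine in \<open>\<tau>\<close>:
  \<open>\<Prod>\<^sub>l (z - \<lambda>\<^sub>l) - \<tau> \<Sum>\<^sub>l (v \<bullet> u\<^sub>l)\<^sup>2 \<Prod>\<^sub>m\<^sub>\<noteq>\<^sub>l (z - \<lambda>\<^sub>m)\<close>. For an eigenvalue of multiplicity \<open>m\<close>, a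
  common factor shows that \<open>m - 1\<close> copies stay in place, while the remaining simple root moves
  differentiably, with speed the sum of \<open>(v \<bullet> u\<^sub>l)\<^sup>2\<close> over the eigenspace. The strict inequalities
  around the tail average make \<open>\<iota>\<close> locally constant and keep the first \<open>\<iota>\<close> eigenvalues apart from
  the others, so \<open>\<Gamma>\<^sub>s\<close> is locally an explicit function of these branches, symmetric in each of the
  two groups; hence the order of the eigenvalues within a group does not matter.
\<close>

section \<open>Determinants of a diagonal matrix plus a rank one matrix\<close>

text \<open>If a permutation moves \<open>l\<close>, it also moves \<open>p l\<close>, and one of
  these two indices differs from \<open>i\<close>; there the Leibniz product meets a zero off the
  diagonal. Hence only the identity contributes.\<close>

lemma det_diagonal_except_row:
  fixes A :: "'a::comm_ring_1 ^ 'n ^ 'n"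
  assumes "\<And>l m. l \<noteq> i \<Longrightarrow> l \<noteq> m \<Longrightarrow> A $ l $ m = 0"
  shows "det A = (\<Prod>l\<in>UNIV. A $ l $ l)"
proof -
  have "(\<Prod>l\<in>UNIV. A $ l $ p l) = 0" if p: "p permutes UNIV" "p \<noteq> id" for p
  proof -
    obtain l where l: "p l \<noteq> l"
      using p(2) by (auto simp: fun_eq_iff)
    have "p (p l) \<noteq> p l"
      using l permutes_inj[OF p(1)] by (auto dest: injD)
    then obtain m where "m \<noteq> i" "p m \<noteq> m"
      using l by metis
    then have "A $ m $ p m = 0"
      using assms by metis
    then show ?thesis
      by (intro prod_zero) auto
  qed
  then have "det A = (\<Sum>p\<in>{id}. of_int (sign p) * (\<Prod>l\<in>UNIV. A $ l $ p l))"
    unfolding det_def by (intro sum.mono_neutral_right) (auto simp: permutes_id finite_permutations)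
  then show ?thesis
    by (simp add: sign_id)
qed

text \<open>The set \<open>S\<close> of rows that carry the rank one part allows an induction. By
  linearity in the new row \<open>i\<close>, the determinant splits into that for \<open>S\<close>
  and \<open>a i\<close> times one whose row \<open>i\<close> is \<open>y\<close> itself. In the
  latter, row operations with row \<open>i\<close> clear the multiples of \<open>y\<close> from all
  other rows, and what remains is diagonal except in row \<open>i\<close>.\<close>

lemma det_diagonal_plus_rank_one_rows:
  fixes a d y :: "'n::finite \<Rightarrow> real"
  assumes "finite S"
  shows "det (\<chi> l m. (if l = m then d l else 0) + (if l \<in> S then a l * y m else 0)) =
    (\<Prod>l\<in>UNIV. d l) + (\<Sum>i\<in>S. a i * y i * (\<Prod>l\<in>UNIV - {i}. d l))"
  using assms
proof (induction S rule: finite_induct)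
  case empty
  then show ?case
    by (subst det_diagonal) auto
next
  case (insert i S)
  define D where "D S l m = (if l = m then d l else 0) + (if l \<in> S then a l * y m else 0)" for S l m
  have replaced: "det (\<chi> l m. if l = i then y m else D T l m) = y i * (\<Prod>l\<in>UNIV - {i}. d l)"
    if "finite T" "i \<notin> T" for T
    using that
  proof (induction T rule: finite_induct)
    case empty
    have "det (\<chi> l m. if l = i then y m else D {} l m) =
        (\<Prod>l\<in>UNIV. if l = i then y i else d l)"
      by (subst det_diagonal_except_row[where i = i]) (auto simp: D_def intro!: prod.cong)
    also have "\<dots> = y i * (\<Prod>l\<in>UNIV - {i}. d l)"
      by (subst prod.remove[of _ i]) (auto intro!: prod.cong)
    finally show ?case .
  next
    case (insert q T)
    define M where "M = (\<chi> l m. if l = i then y m else D T l m)"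
    have "(\<chi> l m. if l = i then y m else D (insert q T) l m) =
        (\<chi> l. if l = q then row q M + a q *s row i M else row l M)"
      using insert by (auto simp: vec_eq_iff M_def row_def D_def)
    then have "det (\<chi> l m. if l = i then y m else D (insert q T) l m) = det M"
      using det_row_operation[of q i M "a q"] insert by auto
    then show ?case
      using insert by (simp add: M_def)
  qed
  have "det (\<chi> l m. D (insert i S) l m) =
      det (\<chi> l. if l = i then (\<chi> m. D S i m) + a i *s (\<chi> m. y m) else (\<chi> m. D S l m))"
    using insert by (intro arg_cong[where f = det]) (auto simp: vec_eq_iff D_def)
  also have "\<dots> = det (\<chi> l. if l = i then (\<chi> m. D S i m) else (\<chi> m. D S l m)) +
      a i * det (\<chi> l. if l = i then (\<chi> m. y m) else (\<chi> m. D S l m))"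
    unfolding det_row_add det_row_mul ..
  also have "(\<chi> l. if l = i then (\<chi> m. D S i m) else (\<chi> m. D S l m)) = (\<chi> l m. D S l m)"
    by (auto simp: vec_eq_iff)
  also have "(\<chi> l. if l = i then (\<chi> m. y m) else (\<chi> m. D S l m)) =
      (\<chi> l m. if l = i then y m else D S l m)"
    by (auto simp: vec_eq_iff)
  finally show ?case
    using insert replaced[of S] by (simp add: D_def algebra_simps)
qed

lemma det_diagonal_plus_rank_one:
  fixes a d y :: "'n::finite \<Rightarrow> real"
  shows "det (\<chi> l m. (if l = m then d l else 0) + a l * y m) =
    (\<Prod>l\<in>UNIV. d l) + (\<Sum>i\<in>UNIV. a i * y i * (\<Prod>l\<in>UNIV - {i}. d l))"
  using det_diagonal_plus_rank_one_rows[of UNIV d a y] by simp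

section \<open>Perturbation of the roots of a polynomial\<close>

lemma isCont_tendsto_nhds: "isCont f a \<Longrightarrow> (f \<longlongrightarrow> f a) (nhds a)"
  by (simp add: isCont_def tendsto_at_iff_tendsto_nhds)

text \<open>To first order \<open>p - smult \<tau> q\<close> at \<open>\<mu> + \<tau> * c\<close>
  equals \<tau> times an affine function of \<open>c\<close> that changes sign at
  \<open>c = w\<close>. The intermediate value theorem thus gives a root within
  \<open>e * \<bar>\<tau>\<bar>\<close> of \<open>\<mu> + \<tau> * w\<close> for each
  \<open>e > 0\<close> and small \<tau>. Choosing the root nearest to
  \<open>\<mu> + \<tau> * w\<close> gives one function that works for all \<open>e\<close>, without
  any uniqueness of roots.\<close>

lemma simple_root_perturbation:
  fixes p q :: "real poly"
  assumes root: "poly p \<mu> = 0" and simple: "poly (pderiv p) \<mu> \<noteq> 0"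
  obtains \<rho> where "\<rho> 0 = \<mu>" "\<forall>\<^sub>F \<tau> in nhds 0. poly (p - smult \<tau> q) (\<rho> \<tau>) = 0"
    "(\<rho> has_real_derivative poly q \<mu> / poly (pderiv p) \<mu>) (at 0)"
proof -
  define w where "w = poly q \<mu> / poly (pderiv p) \<mu>"
  define Z where "Z \<tau> = {z. poly (p - smult \<tau> q) z = 0}" for \<tau>
  have near: "\<forall>\<^sub>F \<tau> in at 0. \<exists>z\<in>Z \<tau>. \<bar>z - (\<mu> + \<tau> * w)\<bar> \<le> e * \<bar>\<tau>\<bar>" if "e > 0" for e
  proof -
    define g where "g c \<tau> = poly (p - smult \<tau> q) (\<mu> + \<tau> * c)" for c \<tau>
    have g_lim: "((\<lambda>\<tau>. g c \<tau> / \<tau>) \<longlongrightarrow> poly (pderiv p) \<mu> * c - poly q \<mu>) (at 0)" for c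
    proof -
      have "(g c has_real_derivative poly (pderiv p) \<mu> * c - poly q \<mu>) (at 0)"
        unfolding g_def by (auto intro!: derivative_eq_intros)
      then show ?thesis
        using root by (simp add: has_field_derivative_iff g_def)
    qed
    \<comment> \<open>The product detects opposite signs whatever the sign of the derivative of
      \<open>p\<close> at \<mu>; the factor 1/\<tau> occurs twice, so the sign of \<tau> does not
      matter either.\<close>
    have "((\<lambda>\<tau>. (g (w - e) \<tau> / \<tau>) * (g (w + e) \<tau> / \<tau>)) \<longlongrightarrow>
        (poly (pderiv p) \<mu> * (w - e) - poly q \<mu>) * (poly (pderiv p) \<mu> * (w + e) - poly q \<mu>)) (at 0)"
      by (intro tendsto_mult g_lim)
    also have "(poly (pderiv p) \<mu> * (w - e) - poly q \<mu>) * (poly (pderiv p) \<mu> * (w + e) - poly q \<mu>)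
        = - (poly (pderiv p) \<mu> * e)\<^sup>2"
      using simple by (simp add: w_def field_simps power2_eq_square)
    finally have "\<forall>\<^sub>F \<tau> in at 0. (g (w - e) \<tau> / \<tau>) * (g (w + e) \<tau> / \<tau>) < 0"
      by (rule order_tendstoD) (use simple that in auto)
    moreover have "\<forall>\<^sub>F \<tau> in at 0. \<tau> \<noteq> (0::real)"
      by (simp add: eventually_at_filter)
    ultimately show ?thesis
    proof eventually_elim
      case (elim \<tau>)
      then have "g (w - e) \<tau> * g (w + e) \<tau> < 0"
        by (simp add: mult_less_0_iff divide_less_0_iff zero_less_divide_iff)
      moreover define a b where "a = \<mu> + \<tau> * w - e * \<bar>\<tau>\<bar>" and "b = \<mu> + \<tau> * w + e * \<bar>\<tau>\<bar>"
      moreover have "\<mu> + \<tau> * (w - e) = (if \<tau> > 0 then a else b)" "\<mu> + \<tau> * (w + e) = (if \<tau> > 0 then b else a)"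
        by (auto simp: a_def b_def algebra_simps)
      ultimately have "poly (p - smult \<tau> q) a * poly (p - smult \<tau> q) b < 0"
        unfolding g_def by (metis mult.commute)
      moreover have "a < b"
        using elim that by (simp add: a_def b_def)
      ultimately obtain z where "a < z" "z < b" "poly (p - smult \<tau> q) z = 0"
        using poly_IVT[of a b "p - smult \<tau> q"] by auto
      then show ?case
        by (intro bexI[of _ z]) (auto simp: Z_def a_def b_def)
    qed
  qed
  \<comment> \<open>A nearest root exists because the zero set is closed. Where
    \<open>Z \<tau>\<close> is empty the choice is arbitrary; by \<open>near\<close> this does not
    happen for small \<tau>.\<close>
  have "\<exists>x. Z \<tau> \<noteq> {} \<longrightarrow> x \<in> Z \<tau> \<and> (\<forall>z\<in>Z \<tau>. dist (\<mu> + \<tau> * w) x \<le> dist (\<mu> + \<tau> * w) z)" for \<tau>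
  proof (cases "Z \<tau> = {}")
    case False
    have "Z \<tau> = poly (p - smult \<tau> q) -` {0}"
      by (auto simp: Z_def)
    moreover have "closed (poly (p - smult \<tau> q) -` {0})"
      by (intro closed_vimage continuous_intros)
    ultimately show ?thesis
      using distance_attains_inf[of "Z \<tau>" "\<mu> + \<tau> * w"] False by metis
  qed auto
  then obtain \<rho> where \<rho>: "\<And>\<tau>. Z \<tau> \<noteq> {} \<Longrightarrow> \<rho> \<tau> \<in> Z \<tau>"
    "\<And>\<tau> z. z \<in> Z \<tau> \<Longrightarrow> dist (\<mu> + \<tau> * w) (\<rho> \<tau>) \<le> dist (\<mu> + \<tau> * w) z"
    by (metis empty_iff)
  have Z0: "\<mu> \<in> Z 0"
    using root by (simp add: Z_def)
  have \<rho>0: "\<rho> 0 = \<mu>"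
    using \<rho>(2)[OF Z0] by simp
  have "\<forall>\<^sub>F \<tau> in at 0. \<rho> \<tau> \<in> Z \<tau>"
    using near[of 1] by (auto elim!: eventually_mono intro: \<rho>(1))
  then have "\<forall>\<^sub>F \<tau> in nhds 0. \<rho> \<tau> \<in> Z \<tau>"
    using Z0 \<rho>0 by (simp add: eventually_nhds_conv_at)
  moreover have "(\<rho> has_real_derivative w) (at 0)"
    unfolding has_field_derivative_iff
  proof (rule tendstoI)
    fix e :: real assume "e > 0"
    then have "\<forall>\<^sub>F \<tau> in at 0. \<exists>z\<in>Z \<tau>. \<bar>z - (\<mu> + \<tau> * w)\<bar> \<le> e / 2 * \<bar>\<tau>\<bar>"
      using near[of "e / 2"] by simp
    moreover have "\<forall>\<^sub>F \<tau> in at 0. \<tau> \<noteq> (0::real)"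
      by (simp add: eventually_at_filter)
    ultimately show "\<forall>\<^sub>F \<tau> in at 0. dist ((\<rho> \<tau> - \<rho> 0) / (\<tau> - 0)) w < e"
    proof eventually_elim
      case (elim \<tau>)
      then obtain z where "z \<in> Z \<tau>" "\<bar>z - (\<mu> + \<tau> * w)\<bar> \<le> e / 2 * \<bar>\<tau>\<bar>"
        by auto
      then have "\<bar>\<rho> \<tau> - (\<mu> + \<tau> * w)\<bar> \<le> e / 2 * \<bar>\<tau>\<bar>"
        using \<rho>(2)[of z \<tau>] by (metis dist_real_def dist_commute order_trans)
      moreover have "(\<rho> \<tau> - \<rho> 0) / \<tau> - w = (\<rho> \<tau> - (\<mu> + \<tau> * w)) / \<tau>"
        using elim \<rho>0 by (simp add: field_simps)
      ultimately have "\<bar>(\<rho> \<tau> - \<rho> 0) / \<tau> - w\<bar> \<le> e / 2"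
        using elim by (simp add: pos_divide_le_eq)
      then show ?case
        using \<open>e > 0\<close> by (simp add: dist_real_def)
    qed
  qed
  ultimately show thesis
    using that[of \<rho>] \<rho>0 by (simp add: Z_def w_def)
qed

text \<open>At the root \<open>\<kappa> i\<close> of the product, every summand of \<open>q\<close>
  but the \<open>i\<close>-th vanishes, and the surviving product \<open>c i\<close> is also the
  derivative of \<open>p\<close> there, so the branch has speed \<open>w i\<close>. By continuity
  the branches stay distinct, so they are all the roots.\<close>

lemma distinct_roots_perturbation:
  fixes \<kappa> w :: "'a \<Rightarrow> real"
  assumes fin: "finite I" and inj: "inj_on \<kappa> I"
  obtains \<rho> where "\<And>i. i \<in> I \<Longrightarrow> \<rho> i 0 = \<kappa> i"
    "\<And>i. i \<in> I \<Longrightarrow> (\<rho> i has_real_derivative w i) (at 0)"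
    "\<forall>\<^sub>F \<tau> in nhds 0. (\<Prod>i\<in>I. [:- \<kappa> i, 1:]) -
       smult \<tau> (\<Sum>i\<in>I. smult (w i) (\<Prod>m\<in>I - {i}. [:- \<kappa> m, 1:])) = (\<Prod>i\<in>I. [:- \<rho> i \<tau>, 1:])"
proof -
  define p where "p = (\<Prod>i\<in>I. [:- \<kappa> i, 1:])"
  define q where "q = (\<Sum>i\<in>I. smult (w i) (\<Prod>m\<in>I - {i}. [:- \<kappa> m, 1:]))"
  define c where "c i = (\<Prod>m\<in>I - {i}. \<kappa> i - \<kappa> m)" for i
  have c_nz: "c i \<noteq> 0" if "i \<in> I" for i
    using fin inj that by (auto simp: c_def inj_on_def)
  have other: "(\<Prod>m\<in>I - {l}. \<kappa> i - \<kappa> m) = (if l = i then c i else 0)" if "i \<in> I" "l \<in> I" for i l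
    using fin that by (auto simp: c_def)
  have p_root: "poly p (\<kappa> i) = 0" if "i \<in> I" for i
    using fin that by (auto simp: p_def poly_prod)
  have p'_root: "poly (pderiv p) (\<kappa> i) = c i" if "i \<in> I" for i
  proof -
    have "poly (pderiv p) (\<kappa> i) = (\<Sum>l\<in>I. \<Prod>m\<in>I - {l}. \<kappa> i - \<kappa> m)"
      by (simp add: p_def pderiv_prod poly_sum poly_prod pderiv_pCons)
    also have "\<dots> = (\<Sum>l\<in>I. if l = i then c i else 0)"
      using other that by (intro sum.cong) auto
    finally show ?thesis
      using fin that by simp
  qed
  have q_root: "poly q (\<kappa> i) = w i * c i" if "i \<in> I" for i
  proof -
    have "poly q (\<kappa> i) = (\<Sum>l\<in>I. w l * (\<Prod>m\<in>I - {l}. \<kappa> i - \<kappa> m))"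
      by (simp add: q_def poly_sum poly_prod)
    also have "\<dots> = (\<Sum>l\<in>I. if l = i then w i * c i else 0)"
      using other that by (intro sum.cong) auto
    finally show ?thesis
      using fin that by simp
  qed
  have "\<exists>\<rho>. \<rho> 0 = \<kappa> i \<and> (\<forall>\<^sub>F \<tau> in nhds 0. poly (p - smult \<tau> q) (\<rho> \<tau>) = 0) \<and>
      (\<rho> has_real_derivative w i) (at 0)" if "i \<in> I" for i
    using simple_root_perturbation[of p "\<kappa> i" q] p_root[OF that] p'_root[OF that] q_root[OF that]
      c_nz[OF that] by (metis nonzero_mult_div_cancel_right)
  then obtain \<rho> where \<rho>: "\<And>i. i \<in> I \<Longrightarrow> \<rho> i 0 = \<kappa> i"
    "\<And>i. i \<in> I \<Longrightarrow> \<forall>\<^sub>F \<tau> in nhds 0. poly (p - smult \<tau> q) (\<rho> i \<tau>) = 0"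
    "\<And>i. i \<in> I \<Longrightarrow> (\<rho> i has_real_derivative w i) (at 0)"
    by metis
  have "\<forall>\<^sub>F \<tau> in nhds 0. \<forall>i\<in>I. poly (p - smult \<tau> q) (\<rho> i \<tau>) = 0"
    using \<rho>(2) by (intro eventually_ball_finite fin) auto
  moreover have "\<forall>\<^sub>F \<tau> in nhds 0. \<forall>i\<in>I. \<forall>m\<in>I. i \<noteq> m \<longrightarrow> \<rho> i \<tau> \<noteq> \<rho> m \<tau>"
  proof (intro eventually_ball_finite fin ballI)
    fix i m assume im: "i \<in> I" "m \<in> I"
    show "\<forall>\<^sub>F \<tau> in nhds 0. i \<noteq> m \<longrightarrow> \<rho> i \<tau> \<noteq> \<rho> m \<tau>"
    proof (cases "i = m")
      case False
      have "isCont (\<lambda>\<tau>. \<rho> i \<tau> - \<rho> m \<tau>) 0"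
        using \<rho>(3) im by (intro continuous_intros DERIV_isCont)
      then have "((\<lambda>\<tau>. \<rho> i \<tau> - \<rho> m \<tau>) \<longlongrightarrow> \<kappa> i - \<kappa> m) (nhds 0)"
        using isCont_tendsto_nhds \<rho>(1) im by fastforce
      moreover have "\<kappa> i - \<kappa> m \<noteq> 0"
        using inj im False by (auto simp: inj_on_def)
      ultimately have "\<forall>\<^sub>F \<tau> in nhds 0. \<rho> i \<tau> - \<rho> m \<tau> \<noteq> 0"
        by (rule tendsto_imp_eventually_ne)
      then show ?thesis
        by (auto elim: eventually_mono)
    qed auto
  qed
  ultimately have "\<forall>\<^sub>F \<tau> in nhds 0. p - smult \<tau> q = (\<Prod>i\<in>I. [:- \<rho> i \<tau>, 1:])"
  proof eventually_elim
    case (elim \<tau>)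
    show ?case
    \<comment> \<open>The bound \<open>degree q < card I\<close> below fails for empty
      \<open>I\<close>.\<close>
    proof (cases "I = {}")
      case True
      then show ?thesis
        by (simp add: p_def q_def)
    next
      case False
      have deg: "degree (\<Prod>i\<in>J. [:- f i, 1:]) = card J" for J :: "'a set" and f :: "'a \<Rightarrow> real"
        by (subst degree_prod_sum_eq) auto
      have lead: "coeff (\<Prod>i\<in>I. [:- f i, 1:]) (card I) = 1" for f :: "'a \<Rightarrow> real"
        using lead_coeff_prod[of "\<lambda>i. [:- f i, 1:]" I] by (simp add: deg)
      have deg_q: "degree q < card I"
        unfolding q_def using False fin
        by (intro degree_sum_less) (auto simp: card_gt_0_iff deg card_Diff_singleton intro!: le_less_trans[OF degree_smult_le])
      have "inj_on (\<lambda>i. \<rho> i \<tau>) I"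
        using elim by (auto simp: inj_on_def)
      then have card: "card ((\<lambda>i. \<rho> i \<tau>) ` I) = card I"
        by (rule card_image)
      show ?thesis
      \<comment> \<open>Both sides are monic of degree \<open>card I\<close>, since \<open>q\<close>
        has smaller degree, so agreement at the \<open>card I\<close> distinct branch values
        suffices.\<close>
      proof (rule poly_eqI_degree_lead_coeff[of _ "card I" _ "(\<lambda>i. \<rho> i \<tau>) ` I"])
        show "coeff (p - smult \<tau> q) (card I) = coeff (\<Prod>i\<in>I. [:- \<rho> i \<tau>, 1:]) (card I)"
          using deg_q by (simp add: lead p_def coeff_eq_0)
        show "degree (p - smult \<tau> q) \<le> card I"
          using deg_q degree_smult_le[of \<tau> q] by (intro degree_diff_le) (auto simp: p_def deg)
        show "poly (p - smult \<tau> q) z = poly (\<Prod>i\<in>I. [:- \<rho> i \<tau>, 1:]) z"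
          if "z \<in> (\<lambda>i. \<rho> i \<tau>) ` I" for z
          using that elim fin by (auto simp: poly_prod)
      qed (simp_all add: card deg)
    qed
  qed
  then show thesis
    using that[of \<rho>] \<rho> by (simp add: p_def q_def)
qed

text \<open>
  Of several equal roots only one representative moves; it carries the total weight of its group,
  which is why the derivatives \<open>d\<close> agree with the weights \<open>w\<close> only after summation against functions
  of the roots.
\<close>

lemma roots_perturbation:
  fixes \<kappa> w :: "'a \<Rightarrow> real"
  assumes fin: "finite A"
  obtains \<rho> d where "\<And>l. l \<in> A \<Longrightarrow> \<rho> l 0 = \<kappa> l"
    "\<And>l. l \<in> A \<Longrightarrow> (\<rho> l has_real_derivative d l) (at 0)"
    "\<forall>\<^sub>F \<tau> in nhds 0. (\<Prod>l\<in>A. [:- \<kappa> l, 1:]) -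
       smult \<tau> (\<Sum>l\<in>A. smult (w l) (\<Prod>m\<in>A - {l}. [:- \<kappa> m, 1:])) = (\<Prod>l\<in>A. [:- \<rho> l \<tau>, 1:])"
    "\<And>g. (\<Sum>l\<in>A. g (\<kappa> l) * d l) = (\<Sum>l\<in>A. g (\<kappa> l) * w l)"
proof -
  define rep where "rep l = (SOME i. i \<in> A \<and> \<kappa> i = \<kappa> l)" for l
  have rep: "rep l \<in> A" "\<kappa> (rep l) = \<kappa> l" if "l \<in> A" for l
    using someI[of "\<lambda>i. i \<in> A \<and> \<kappa> i = \<kappa> l" l] that unfolding rep_def by blast+
  have rep_cong: "rep l = rep m" if "\<kappa> l = \<kappa> m" for l m
    using that by (simp only: rep_def)
  define I where "I = rep ` A"
  define W where "W i = (\<Sum>l\<in>{l\<in>A. rep l = i}. w l)" for i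
  have I: "I \<subseteq> A" "finite I"
    using rep(1) fin by (auto simp: I_def)
  have inj: "inj_on \<kappa> I"
    unfolding inj_on_def I_def using rep rep_cong by (metis imageE)
  have group: "(\<Sum>i\<in>I. \<Sum>l\<in>{l\<in>A. rep l = i}. h l) = sum h A" for h :: "'a \<Rightarrow> 'b::comm_monoid_add"
    unfolding I_def using fin by (intro sum.group) auto
  obtain \<sigma> where \<sigma>: "\<And>i. i \<in> I \<Longrightarrow> \<sigma> i 0 = \<kappa> i"
    "\<And>i. i \<in> I \<Longrightarrow> (\<sigma> i has_real_derivative W i) (at 0)"
    "\<forall>\<^sub>F \<tau> in nhds 0. (\<Prod>i\<in>I. [:- \<kappa> i, 1:]) -
       smult \<tau> (\<Sum>i\<in>I. smult (W i) (\<Prod>m\<in>I - {i}. [:- \<kappa> m, 1:])) = (\<Prod>i\<in>I. [:- \<sigma> i \<tau>, 1:])"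
    using distinct_roots_perturbation[OF I(2) inj, of W] by blast
  define R where "R = (\<Prod>l\<in>A - I. [:- \<kappa> l, 1:])"
  define \<rho> where "\<rho> l \<tau> = (if l \<in> I then \<sigma> l \<tau> else \<kappa> l)" for l \<tau>
  define d where "d l = (if l \<in> I then W l else 0)" for l
  have split: "(\<Prod>l\<in>A. f l) = (\<Prod>l\<in>A - I. f l) * (\<Prod>l\<in>I. f l)" for f :: "'a \<Rightarrow> real poly"
    by (rule prod.subset_diff[OF I(1) fin])
  \<comment> \<open>Since \<open>l\<close> and \<open>rep l\<close> carry the same root, multiplying
    either side by the factor of \<open>l\<close> gives the full product; that factor then cancels.
    Consequently \<open>R\<close> divides both terms of the perturbed polynomial, and only the
    product over the distinct roots is perturbed.\<close>
  have remove: "(\<Prod>m\<in>A - {l}. [:- \<kappa> m, 1:]) = R * (\<Prod>m\<in>I - {rep l}. [:- \<kappa> m, 1:])" if "l \<in> A" for l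
  proof -
    have "rep l \<in> I"
      using that by (simp add: I_def)
    have "[:- \<kappa> l, 1:] * (\<Prod>m\<in>A - {l}. [:- \<kappa> m, 1:]) = (\<Prod>m\<in>A. [:- \<kappa> m, 1:])"
      using fin that by (rule prod.remove[symmetric])
    also have "\<dots> = R * (\<Prod>m\<in>I. [:- \<kappa> m, 1:])"
      unfolding R_def by (rule split)
    also have "(\<Prod>m\<in>I. [:- \<kappa> m, 1:]) = [:- \<kappa> (rep l), 1:] * (\<Prod>m\<in>I - {rep l}. [:- \<kappa> m, 1:])"
      using I(2) \<open>rep l \<in> I\<close> by (rule prod.remove)
    finally have "[:- \<kappa> l, 1:] * (\<Prod>m\<in>A - {l}. [:- \<kappa> m, 1:]) =
        [:- \<kappa> l, 1:] * (R * (\<Prod>m\<in>I - {rep l}. [:- \<kappa> m, 1:]))"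
      unfolding rep(2)[OF that] by (simp only: mult.left_commute)
    then show ?thesis
      by (subst (asm) mult_cancel_left) auto
  qed
  have "(\<Sum>l\<in>A. smult (w l) (\<Prod>m\<in>A - {l}. [:- \<kappa> m, 1:])) =
      (\<Sum>i\<in>I. \<Sum>l\<in>{l\<in>A. rep l = i}. smult (w l) (\<Prod>m\<in>A - {l}. [:- \<kappa> m, 1:]))"
    by (rule group[symmetric])
  also have "\<dots> = (\<Sum>i\<in>I. \<Sum>l\<in>{l\<in>A. rep l = i}. smult (w l) (R * (\<Prod>m\<in>I - {i}. [:- \<kappa> m, 1:])))"
    by (intro sum.cong refl) (auto simp: remove)
  also have "\<dots> = R * (\<Sum>i\<in>I. smult (W i) (\<Prod>m\<in>I - {i}. [:- \<kappa> m, 1:]))"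
    by (simp add: W_def sum_distrib_left smult_sum)
  finally have sum_eq: "(\<Sum>l\<in>A. smult (w l) (\<Prod>m\<in>A - {l}. [:- \<kappa> m, 1:])) =
      R * (\<Sum>i\<in>I. smult (W i) (\<Prod>m\<in>I - {i}. [:- \<kappa> m, 1:]))" .
  show thesis
  proof (rule that[of \<rho> d])
    show "\<rho> l 0 = \<kappa> l" for l
      using \<sigma>(1) by (simp add: \<rho>_def)
    show "(\<rho> l has_real_derivative d l) (at 0)" for l
      using \<sigma>(2) by (cases "l \<in> I") (simp_all add: \<rho>_def[abs_def] d_def)
    show "\<forall>\<^sub>F \<tau> in nhds 0. (\<Prod>l\<in>A. [:- \<kappa> l, 1:]) -
       smult \<tau> (\<Sum>l\<in>A. smult (w l) (\<Prod>m\<in>A - {l}. [:- \<kappa> m, 1:])) = (\<Prod>l\<in>A. [:- \<rho> l \<tau>, 1:])"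
      using \<sigma>(3)
    proof eventually_elim
      case (elim \<tau>)
      have "(\<Prod>l\<in>A. [:- \<rho> l \<tau>, 1:]) = R * (\<Prod>i\<in>I. [:- \<sigma> i \<tau>, 1:])"
        unfolding split R_def by (intro arg_cong2[where f = "(*)"] prod.cong) (auto simp: \<rho>_def)
      then show ?case
        unfolding sum_eq elim[symmetric] split[of "\<lambda>l. [:- \<kappa> l, 1:]"]
        by (simp add: R_def algebra_simps)
    qed
    show "(\<Sum>l\<in>A. g (\<kappa> l) * d l) = (\<Sum>l\<in>A. g (\<kappa> l) * w l)" for g
    proof -
      have "(\<Sum>l\<in>A. g (\<kappa> l) * d l) = (\<Sum>i\<in>I. g (\<kappa> i) * W i)"
        using I fin by (intro sum.mono_neutral_cong_right) (auto simp: d_def)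
      also have "\<dots> = (\<Sum>i\<in>I. \<Sum>l\<in>{l\<in>A. rep l = i}. g (\<kappa> l) * w l)"
        unfolding W_def sum_distrib_left by (intro sum.cong refl) (use rep(2) in force)
      finally show ?thesis
        by (simp only: group)
    qed
  qed
qed

section \<open>The characteristic polynomial and its rank one update\<close>

lemma poly_char_polynomial:
  fixes X :: "real ^ 'k ^ 'k"
  shows "poly (char_polynomial X) z = det (\<chi> i j. (if i = j then z else 0) - X $ i $ j)"
proof -
  have "poly (of_int (sign p)) z = of_int (sign p)" for p :: "'k \<Rightarrow> 'k"
    by (simp add: sign_def)
  then show ?thesis
    by (simp add: char_polynomial_def det_def poly_sum poly_prod if_distrib[of "\<lambda>p. poly p z"]
        cong: if_cong)
qed

text \<open>A root makes \<open>M\<close> singular; a kernel vector \<open>x\<close> is an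
  eigenvector of \<open>X\<close>, and \<open>z * (x \<bullet> x)\<close> is the value of the
  quadratic form at \<open>x\<close>.\<close>

lemma char_polynomial_root_nonneg:
  fixes X :: "real ^ 'k ^ 'k"
  assumes psd: "\<And>v. 0 \<le> v \<bullet> (X *v v)" and root: "poly (char_polynomial X) z = 0"
  shows "0 \<le> z"
proof -
  define M where "M = (\<chi> i j. (if i = j then z else 0) - X $ i $ j)"
  have "det M = 0"
    using root by (simp add: poly_char_polynomial M_def)
  then obtain x where x: "x \<noteq> 0" "M *v x = 0"
    by (metis invertible_det_nz invertible_left_inverse matrix_left_invertible_ker)
  have "M *v x = z *\<^sub>R x - X *v x"
    by (simp add: vec_eq_iff M_def matrix_vector_mult_def left_diff_distrib sum_subtractf
        if_distrib[of "\<lambda>t. t * _"] cong: if_cong)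
  then have "z * (x \<bullet> x) = x \<bullet> (X *v x)"
    using x by (simp add: inner_scaleR_right[symmetric] del: inner_scaleR_right)
  then have "0 \<le> z * (x \<bullet> x)"
    using psd by simp
  then show ?thesis
    using x(1) by (simp add: zero_le_mult_iff)
      (metis inner_gt_zero_iff not_le)
qed

lemma outer_mult_vec: "outer a b *v x = (b \<bullet> x) *\<^sub>R a"
  by (simp add: vec_eq_iff outer_def matrix_vector_mult_def inner_vec_def sum_distrib_left
      mult_ac)

lemma matrix_sum_mult_vec: "(\<Sum>l\<in>A. M l) *v x = (\<Sum>l\<in>A. M l *v x)"
  for M :: "'a \<Rightarrow> real ^ 'n ^ 'm"
  by (induction A rule: infinite_finite_induct) (simp_all add: matrix_vector_mult_add_rdistrib)

text \<open>Conjugation with the orthogonal matrix of the eigenvectors preserves the determinant and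
  turns the matrix into a diagonal one minus \<tau> times the outer square of the coordinates
  \<open>v \<bullet> u l\<close>. The identity is checked at each \<open>z\<close>.\<close>

lemma char_polynomial_rank_one_update:
  fixes u :: "nat \<Rightarrow> real ^ 'k" and v :: "real ^ 'k" and \<kappa> :: "nat \<Rightarrow> real"
  assumes orth: "\<forall>l\<in>{1..CARD('k)}. \<forall>m\<in>{1..CARD('k)}. u l \<bullet> u m = (if l = m then 1 else 0)"
    and X: "X = (\<Sum>l = 1..CARD('k). \<kappa> l *\<^sub>R outer (u l) (u l))"
  shows "char_polynomial (X + \<tau> *\<^sub>R outer v v) = (\<Prod>l = 1..CARD('k). [:- \<kappa> l, 1:]) -
    smult \<tau> (\<Sum>l = 1..CARD('k). smult ((v \<bullet> u l)\<^sup>2) (\<Prod>m\<in>{1..CARD('k)} - {l}. [:- \<kappa> m, 1:]))"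
proof (rule poly_ext)
  fix z
  let ?K = "{1..CARD('k)}"
  \<comment> \<open>Matrix indices range over the type \<open>'k\<close>, eigenvectors over numbers
    starting at 1; \<pi> translates.\<close>
  obtain \<pi> where \<pi>: "bij_betw \<pi> (UNIV :: 'k set) ?K"
    using finite_same_card_bij[of "UNIV :: 'k set" ?K] by auto
  have \<pi>_mem: "\<pi> i \<in> ?K" for i
    using \<pi> by (auto simp: bij_betw_def)
  have \<pi>_eq: "\<pi> i = \<pi> j \<longleftrightarrow> i = j" for i j
    using \<pi> by (auto simp: bij_betw_def inj_on_def)
  define M where "M = (\<chi> i j. (if i = j then z else 0) - (X + \<tau> *\<^sub>R outer v v) $ i $ j)"
  define U :: "real ^ 'k ^ 'k" where "U = (\<chi> i. u (\<pi> i))"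
  define y where "y i = v \<bullet> u (\<pi> i)" for i
  have "U ** transpose U = mat 1"
    using orth \<pi>_mem
    by (simp add: vec_eq_iff matrix_matrix_mult_def U_def transpose_def mat_def \<pi>_eq
        flip: inner_vec_def[where 'a = real, simplified inner_real_def])
  then have "det U * det U = 1"
    by (metis det_I det_mul det_transpose)
  then have "det M = det (U ** M ** transpose U)"
    by (simp add: det_mul det_transpose)
  have M_vec: "M *v x = z *\<^sub>R x - (\<Sum>l\<in>?K. (\<kappa> l * (u l \<bullet> x)) *\<^sub>R u l) - (\<tau> * (v \<bullet> x)) *\<^sub>R v" for x
  proof -
    have "M *v x = z *\<^sub>R x - (X + \<tau> *\<^sub>R outer v v) *v x"
      by (simp add: vec_eq_iff M_def matrix_vector_mult_def left_diff_distrib sum_subtractf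
          if_distrib[of "\<lambda>t. t * _"] cong: if_cong)
    then show ?thesis
      by (simp add: X matrix_vector_mult_add_rdistrib matrix_sum_mult_vec outer_mult_vec
          flip: scaleR_matrix_vector_assoc)
  qed
  have U_col: "M *v u (\<pi> j) = (z - \<kappa> (\<pi> j)) *\<^sub>R u (\<pi> j) - (\<tau> * y j) *\<^sub>R v" for j
  proof -
    have "(\<Sum>l\<in>?K. (\<kappa> l * (u l \<bullet> u (\<pi> j))) *\<^sub>R u l) = (\<Sum>l\<in>?K. if l = \<pi> j then \<kappa> l *\<^sub>R u l else 0)"
      using orth \<pi>_mem by (intro sum.cong) auto
    also have "\<dots> = \<kappa> (\<pi> j) *\<^sub>R u (\<pi> j)"
      using \<pi>_mem[of j] by simp
    finally show ?thesis
      by (simp add: M_vec y_def algebra_simps)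
  qed
  have "(U ** M ** transpose U) $ i $ j =
      (if i = j then z - \<kappa> (\<pi> i) else 0) + - \<tau> * y i * y j" for i j
  proof -
    have "(U ** M ** transpose U) $ i $ j = u (\<pi> i) \<bullet> (M *v u (\<pi> j))"
      unfolding matrix_mul_assoc[symmetric]
      by (simp add: inner_vec_def U_def matrix_matrix_mult_def matrix_vector_mult_def transpose_def)
    also have "\<dots> = (z - \<kappa> (\<pi> j)) * (if i = j then 1 else 0) - \<tau> * y j * y i"
      using orth \<pi>_mem by (simp add: U_col inner_diff_right \<pi>_eq y_def inner_commute)
    finally show ?thesis
      by simp
  qed
  then have "U ** M ** transpose U =
      (\<chi> i j. (if i = j then z - \<kappa> (\<pi> i) else 0) + (- \<tau> * y i) * y j)"
    by (simp add: vec_eq_iff)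
  then have "det M = (\<Prod>i\<in>UNIV. z - \<kappa> (\<pi> i)) +
      (\<Sum>i\<in>UNIV. (- \<tau> * y i) * y i * (\<Prod>m\<in>UNIV - {i}. z - \<kappa> (\<pi> m)))"
    unfolding \<open>det M = _\<close> by (simp only: det_diagonal_plus_rank_one)
  also have "(\<Prod>i\<in>UNIV. z - \<kappa> (\<pi> i)) = (\<Prod>l\<in>?K. z - \<kappa> l)"
    by (rule prod.reindex_bij_betw[OF \<pi>])
  also have "(\<Sum>i\<in>UNIV. (- \<tau> * y i) * y i * (\<Prod>m\<in>UNIV - {i}. z - \<kappa> (\<pi> m))) =
      (\<Sum>i\<in>UNIV. - \<tau> * (v \<bullet> u (\<pi> i))\<^sup>2 * (\<Prod>m\<in>?K - {\<pi> i}. z - \<kappa> m))"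
  proof (rule sum.cong)
    fix i
    have "bij_betw \<pi> (UNIV - {i}) (?K - {\<pi> i})"
      using \<pi> by (auto simp: bij_betw_def inj_on_def)
    from prod.reindex_bij_betw[OF this, of "\<lambda>m. z - \<kappa> m"]
    show "(- \<tau> * y i) * y i * (\<Prod>m\<in>UNIV - {i}. z - \<kappa> (\<pi> m)) =
        - \<tau> * (v \<bullet> u (\<pi> i))\<^sup>2 * (\<Prod>m\<in>?K - {\<pi> i}. z - \<kappa> m)"
      by (simp add: y_def power2_eq_square)
  qed simp
  also have "\<dots> = (\<Sum>l\<in>?K. - \<tau> * (v \<bullet> u l)\<^sup>2 * (\<Prod>m\<in>?K - {l}. z - \<kappa> m))"
    by (rule sum.reindex_bij_betw[OF \<pi>])
  finally show "poly (char_polynomial (X + \<tau> *\<^sub>R outer v v)) z = poly ((\<Prod>l = 1..CARD('k). [:- \<kappa> l, 1:]) -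
    smult \<tau> (\<Sum>l = 1..CARD('k). smult ((v \<bullet> u l)\<^sup>2) (\<Prod>m\<in>{1..CARD('k)} - {l}. [:- \<kappa> m, 1:]))) z"
    by (simp add: poly_char_polynomial M_def poly_prod poly_sum sum_distrib_left sum_negf mult.assoc)
qed

section \<open>Ordered eigenvalues of two separated groups of roots\<close>

text \<open>The gap between \<open>b\<close> and \<open>c\<close> makes the decreasing list of roots
  the concatenation of the two sorted groups. Within a group the order of the \<rho> is unknown, so
  only symmetric sums are compared; the logarithm on the upper group and the identity on the lower
  one are the cases needed for \<open>phi\<close>.\<close>

lemma eigval_split:
  fixes X :: "real ^ 'k ^ 'k" and \<rho> :: "nat \<Rightarrow> real"
  assumes cp: "char_polynomial X = (\<Prod>l = 1..CARD('k). [:- \<rho> l, 1:])"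
    and i: "i \<le> CARD('k)"
    and hi: "\<And>l. l \<in> {1..i} \<Longrightarrow> c < \<rho> l" and lo: "\<And>l. l \<in> {i + 1..CARD('k)} \<Longrightarrow> \<rho> l < b"
    and bc: "b \<le> c"
  shows "(\<Sum>l = 1..i. f (eigval X l)) = (\<Sum>l = 1..i. f (\<rho> l))"
    and "(\<Sum>l = i + 1..CARD('k). f (eigval X l)) = (\<Sum>l = i + 1..CARD('k). f (\<rho> l))"
    and "\<And>l. 1 \<le> l \<Longrightarrow> l \<le> i \<Longrightarrow> c < eigval X l"
    and "\<And>l. i < l \<Longrightarrow> l \<le> CARD('k) \<Longrightarrow> eigval X l < b"
    and "\<And>l m. 1 \<le> l \<Longrightarrow> l \<le> m \<Longrightarrow> m \<le> CARD('k) \<Longrightarrow> eigval X m \<le> eigval X l"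
    and "\<And>l. 1 \<le> l \<Longrightarrow> l \<le> CARD('k) \<Longrightarrow> poly (char_polynomial X) (eigval X l) = 0"
proof -
  define xs where "xs = rev (sort (map \<rho> [1..<i + 1]))"
  define ys where "ys = rev (sort (map \<rho> [i + 1..<CARD('k) + 1]))"
  have len: "length xs = i" "length ys = CARD('k) - i"
    by (simp_all add: xs_def ys_def del: upt_Suc)
  have sorted: "sorted (rev xs)" "sorted (rev ys)"
    by (simp_all add: xs_def ys_def)
  have set: "set xs = \<rho> ` {1..i}" "set ys = \<rho> ` {i + 1..CARD('k)}"
    by (simp_all add: xs_def ys_def atLeastLessThanSuc_atLeastAtMost del: upt_Suc)
  have upt: "[1..<CARD('k) + 1] = [1..<i + 1] @ [i + 1..<CARD('k) + 1]"
    using i upt_add_eq_append[of 1 "i + 1" "CARD('k) - i"] by (simp del: upt_Suc)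
  have "proots (char_polynomial X) = (\<Sum>l\<in>{1..CARD('k)}. {#\<rho> l#})"
    unfolding cp by (subst proots_prod) auto
  also have "\<dots> = mset (map \<rho> [1..<CARD('k) + 1])"
    by (simp add: sum_unfold_sum_mset atLeastLessThanSuc_atLeastAtMost del: upt_Suc)
  also have "\<dots> = mset (rev ys @ rev xs)"
    unfolding upt by (simp add: xs_def ys_def del: upt_Suc)
  finally have "sorted_list_of_multiset (proots (char_polynomial X)) = sort (rev ys @ rev xs)"
    by (simp only: sorted_list_of_multiset_mset)
  moreover have "sorted (rev ys @ rev xs)"
    using sorted hi lo bc by (fastforce simp: sorted_append set)
  ultimately have ev: "rev (sorted_list_of_multiset (proots (char_polynomial X))) = xs @ ys"
    by (simp add: sorted_sort_id)
  have eig: "eigval X l = (xs @ ys) ! (l - 1)" for l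
    by (simp add: eigval_def ev)
  have total: "length (xs @ ys) = CARD('k)"
    using i len by simp
  have eig_hi: "eigval X l \<in> set xs" if "1 \<le> l" "l \<le> i" for l
  proof -
    have "l - 1 < length xs"
      using that len by auto
    then show ?thesis
      by (simp add: eig nth_append)
  qed
  have eig_lo: "eigval X l \<in> set ys" if "i < l" "l \<le> CARD('k)" for l
  proof -
    have "\<not> l - 1 < length xs" "l - 1 - length xs < length ys"
      using that len by auto
    then show ?thesis
      by (simp add: eig nth_append)
  qed
  \<comment> \<open>Sorting and reversing preserve the multiset of values.\<close>
  have sum_sort: "sum_list (map f (rev (sort (map \<rho> ns)))) = sum_list (map (\<lambda>l. f (\<rho> l)) ns)" for ns
    unfolding sum_mset_sum_list[symmetric] by (simp add: image_mset.compositionality comp_def)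
  have "(\<Sum>l = 1..i. f (eigval X l)) = (\<Sum>l = 0..<i. f (xs ! l))"
    by (rule sum.reindex_bij_witness[of _ Suc "\<lambda>l. l - 1"]) (auto simp: eig nth_append len)
  also have "\<dots> = sum_list (map f xs)"
    by (simp add: sum_list_sum_nth len)
  also have "\<dots> = (\<Sum>l = 1..i. f (\<rho> l))"
    unfolding xs_def sum_sort by (simp add: sum_list_distinct_conv_sum_set atLeastLessThanSuc_atLeastAtMost del: upt_Suc)
  finally show "(\<Sum>l = 1..i. f (eigval X l)) = (\<Sum>l = 1..i. f (\<rho> l))" .
  have "(\<Sum>l = i + 1..CARD('k). f (eigval X l)) = (\<Sum>l = 0..<CARD('k) - i. f (ys ! l))"
    by (rule sum.reindex_bij_witness[of _ "\<lambda>l. l + (i + 1)" "\<lambda>l. l - (i + 1)"])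
      (auto simp: eig nth_append len diff_diff_add)
  also have "\<dots> = sum_list (map f ys)"
    by (simp add: sum_list_sum_nth len)
  also have "\<dots> = (\<Sum>l = i + 1..CARD('k). f (\<rho> l))"
    unfolding ys_def sum_sort by (simp add: sum_list_distinct_conv_sum_set atLeastLessThanSuc_atLeastAtMost del: upt_Suc)
  finally show "(\<Sum>l = i + 1..CARD('k). f (eigval X l)) = (\<Sum>l = i + 1..CARD('k). f (\<rho> l))" .
  show "c < eigval X l" if "1 \<le> l" "l \<le> i" for l
    using eig_hi[OF that] hi by (auto simp: set)
  show "eigval X l < b" if "i < l" "l \<le> CARD('k)" for l
    using eig_lo[OF that] lo by (auto simp: set)
  show "eigval X m \<le> eigval X l" if "1 \<le> l" "l \<le> m" "m \<le> CARD('k)" for l m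
    unfolding eig using that \<open>sorted (rev ys @ rev xs)\<close> total
    by (intro sorted_rev_nth_mono) auto
  show "poly (char_polynomial X) (eigval X l) = 0" if "1 \<le> l" "l \<le> CARD('k)" for l
  proof -
    have "eigval X l \<in> set (xs @ ys)"
      unfolding eig using that total by (intro nth_mem) auto
    also have "set (xs @ ys) \<subseteq> \<rho> ` {1..CARD('k)}"
      using i by (auto simp: set)
    finally show ?thesis
      by (auto simp: cp poly_prod)
  qed
qed

section \<open>The quadratic form of \<open>Fmap\<close> and the change of one coordinate\<close>

lemma Fmap_psd:
  assumes "\<And>i. 0 \<le> x $ i"
  shows "0 \<le> v \<bullet> (Fmap F x *v v)"
proof -
  have "Fmap F x *v v = (\<Sum>j\<in>UNIV. (x $ j * (row j F \<bullet> v)) *\<^sub>R row j F)"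
    by (simp add: Fmap_def matrix_sum_mult_vec outer_mult_vec flip: scaleR_matrix_vector_assoc)
  then have "v \<bullet> (Fmap F x *v v) = (\<Sum>j\<in>UNIV. x $ j * (row j F \<bullet> v)\<^sup>2)"
    by (simp add: inner_sum_right power2_eq_square inner_commute mult.assoc)
  then show ?thesis
    using assms by (simp add: sum_nonneg)
qed

lemma Fmap_update:
  "Fmap F (\<chi> i. if i = j then t else x $ i) = Fmap F x + (t - x $ j) *\<^sub>R outer (row j F) (row j F)"
proof -
  have "Fmap F (\<chi> i. if i = j then t else x $ i) - Fmap F x =
      (\<Sum>i\<in>UNIV. if i = j then (t - x $ i) *\<^sub>R outer (row i F) (row i F) else 0)"
    unfolding Fmap_def sum_subtractf[symmetric]
    by (intro sum.cong) (auto simp: scaleR_diff_left)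
  then show ?thesis
    by (simp add: algebra_simps)
qed


section \<open>The partial derivative of \<open>Gam\<close> along \<open>Fmap\<close>\<close>

theorem theorem2p10:
  fixes C :: "real ^ 'n ^ 'n" and F :: "real ^ 'k ^ 'n" and r s :: nat
    and xh :: "real ^ 'n" and lamh :: "nat \<Rightarrow> real" and uh :: "nat \<Rightarrow> real ^ 'k" and ih :: nat and j :: 'n
  assumes "CARD('n) > 1" and "0 < s" and "s < CARD('n)"
    and "pos_semidef C" and "rank C = r" and "r \<ge> s"
    and "C = F ** transpose F" and "r \<le> CARD('k)" and "CARD('k) \<le> CARD('n)"
    and "\<forall>i. 0 \<le> xh $ i \<and> xh $ i \<le> 1"
    and "Fmap F xh = (\<Sum>l = 1..CARD('k). lamh l *\<^sub>R outer (uh l) (uh l))"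
    and "\<forall>l m. 1 \<le> l \<and> l \<le> m \<and> m \<le> CARD('k) \<longrightarrow> lamh m \<le> lamh l"
    and "\<forall>l\<in>{1..CARD('k)}. \<forall>m\<in>{1..CARD('k)}. uh l \<bullet> uh m = (if l = m then 1 else 0)"
    and "ih = iota CARD('k) s lamh"
    and "(\<Sum>l = ih + 1..CARD('k). lamh l) / (real s - real ih) > lamh (ih + 1)"
  shows "((\<lambda>t. Gam s (Fmap F (\<chi> i. if i = j then t else xh $ i))) has_real_derivative
           ((\<Sum>l = 1..ih. (1 / lamh l) * (row j F \<bullet> uh l)\<^sup>2) +
            (\<Sum>l = ih + 1..CARD('k).
               ((real s - real ih) / (\<Sum>i = ih + 1..CARD('k). lamh i)) * (row j F \<bullet> uh l)\<^sup>2)))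
         (at (xh $ j) within {0..1})"
proof -
  let ?k = "CARD('k)" and ?K = "{1..CARD('k)}"
  define v where "v = row j F"
  define X where "X \<tau> = Fmap F xh + \<tau> *\<^sub>R outer v v" for \<tau>
  note s_pos = assms(2) and range = assms(10) and spectral = assms(11) and decr = assms(12)
    and orth = assms(13) and ih = assms(14)
  have s_le: "s \<le> ?k"
    using assms by simp
  have lamh_nonneg: "0 \<le> lamh l" if l: "l \<in> ?K" for l
  proof -
    have "Fmap F xh *v uh l = (\<Sum>m\<in>?K. if m = l then lamh m *\<^sub>R uh m else 0)"
      unfolding spectral matrix_sum_mult_vec using orth l
      by (intro sum.cong) (auto simp: outer_mult_vec simp flip: scaleR_matrix_vector_assoc)
    then have "uh l \<bullet> (Fmap F xh *v uh l) = lamh l"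
      using l orth by simp
    then show ?thesis
      using Fmap_psd[of xh "uh l" F] range by simp
  qed
  define T where "T = tail_avg ?k s lamh ih"
  have "is_iota ?k s lamh ih"
    unfolding ih iota_def by (rule theI', rule is_iota_ex1) (use s_pos s_le lamh_nonneg decr in auto)
  then have ih_less: "ih < s" and T_less: "ih = 0 \<or> T < lamh ih"
    by (auto simp: is_iota_def T_def)
  have ih_le: "ih + 1 \<le> ?k"
    using ih_less s_le by simp
  have T_gt: "lamh (ih + 1) < T"
    using assms(15) by (simp add: T_def tail_avg_def)
  \<comment> \<open>With \<open>lamh_hi\<close> this puts every argument of a logarithm in the local
    formula strictly above 0, away from the default value \<open>ln 0 = 0\<close>.\<close>
  then have T_pos: "0 < T"
    using lamh_nonneg[of "ih + 1"] ih_le by simp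
  have lamh_hi: "T < lamh l" if "l \<in> {1..ih}" for l
    using T_less that decr ih_le by (auto intro: less_le_trans)
  have lamh_lo: "lamh l \<le> lamh (ih + 1)" if "l \<in> {ih + 1..?k}" for l
    using that decr ih_le by auto

  obtain \<rho> d where \<rho>0: "\<And>l. l \<in> ?K \<Longrightarrow> \<rho> l 0 = lamh l"
    and \<rho>': "\<And>l. l \<in> ?K \<Longrightarrow> (\<rho> l has_real_derivative d l) (at 0)"
    and \<rho>_roots: "\<forall>\<^sub>F \<tau> in nhds 0. (\<Prod>l\<in>?K. [:- lamh l, 1:]) -
       smult \<tau> (\<Sum>l\<in>?K. smult ((v \<bullet> uh l)\<^sup>2) (\<Prod>m\<in>?K - {l}. [:- lamh m, 1:])) =
       (\<Prod>l\<in>?K. [:- \<rho> l \<tau>, 1:])"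
    and d_sum: "\<And>g. (\<Sum>l\<in>?K. g (lamh l) * d l) = (\<Sum>l\<in>?K. g (lamh l) * (v \<bullet> uh l)\<^sup>2)"
    using roots_perturbation[of ?K lamh "\<lambda>l. (v \<bullet> uh l)\<^sup>2"] by auto
  have \<rho>_roots: "\<forall>\<^sub>F \<tau> in nhds 0. char_polynomial (X \<tau>) = (\<Prod>l\<in>?K. [:- \<rho> l \<tau>, 1:])"
    using \<rho>_roots unfolding X_def char_polynomial_rank_one_update[OF orth spectral] .
  have \<rho>_lim: "(\<rho> l \<longlongrightarrow> lamh l) (nhds 0)" if "l \<in> ?K" for l
    using isCont_tendsto_nhds[OF DERIV_isCont[OF \<rho>'[OF that]]] \<rho>0[OF that] by simp
  define avg where "avg \<tau> = (\<Sum>l = ih + 1..?k. \<rho> l \<tau>) / (real s - real ih)" for \<tau>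
  have avg_0: "avg 0 = T"
    unfolding avg_def T_def tail_avg_def using \<rho>0 by (intro arg_cong2[where f = "(/)"] sum.cong) auto
  have avg': "(avg has_real_derivative (\<Sum>l = ih + 1..?k. d l) / (real s - real ih)) (at 0)"
    unfolding avg_def by (intro DERIV_cdivide DERIV_sum \<rho>') auto
  have avg_lim: "(avg \<longlongrightarrow> T) (nhds 0)"
    using isCont_tendsto_nhds[OF DERIV_isCont[OF avg']] by (simp add: avg_0)

  \<comment> \<open>The thresholds satisfy \<open>lamh (ih + 1) < b < T < c\<close>, and
    \<open>c\<close> lies below the first \<open>ih\<close> eigenvalues. Near 0 both groups of
    branches and the average stay on their sides, which keeps \<open>is_iota\<close> true at
    \<open>ih\<close>. For \<open>ih = 0\<close> there is no upper group and any \<open>c\<close>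
    above \<open>T\<close> will do.\<close>
  obtain b where b: "lamh (ih + 1) < b" "b < T"
    using dense[OF T_gt] by blast
  obtain c where c: "T < c" "\<And>l. l \<in> {1..ih} \<Longrightarrow> c < lamh l"
  proof (cases "ih = 0")
    case True
    then show ?thesis
      using that[of "T + 1"] by simp
  next
    case False
    then obtain c where "T < c" "c < lamh ih"
      using T_less dense by blast
    moreover have "lamh ih \<le> lamh l" if "l \<in> {1..ih}" for l
      using that decr ih_le by auto
    ultimately show ?thesis
      using that[of c] by fastforce
  qed
  have "\<forall>\<^sub>F \<tau> in nhds 0. \<forall>l\<in>{1..ih}. c < \<rho> l \<tau>"
    by (intro eventually_ball_finite ballI order_tendstoD(1)[OF \<rho>_lim] c(2)) (use ih_le in auto)
  moreover have "\<forall>\<^sub>F \<tau> in nhds 0. \<forall>l\<in>{ih + 1..?k}. \<rho> l \<tau> < b"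
    by (intro eventually_ball_finite ballI order_tendstoD(2)[OF \<rho>_lim] le_less_trans[OF lamh_lo b(1)]) auto
  moreover have "\<forall>\<^sub>F \<tau> in nhds 0. b < avg \<tau>" "\<forall>\<^sub>F \<tau> in nhds 0. avg \<tau> < c"
    using order_tendstoD[OF avg_lim] b(2) c(1) by auto
  \<comment> \<open>Keeping the coordinate in the unit interval keeps \<open>X \<tau>\<close>
    positive semidefinite. Its eigenvalues are then nonnegative, so \<open>is_iota_ex1\<close>
    applies and the index \<open>ih\<close> is the one selected by \<open>iota\<close>.\<close>
  ultimately have Gam_eq: "\<forall>\<^sub>F \<tau> in nhds 0. xh $ j + \<tau> \<in> {0..1} \<longrightarrow>
      Gam s (X \<tau>) = (\<Sum>l = 1..ih. ln (\<rho> l \<tau>)) + (real s - real ih) * ln (avg \<tau>)"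
    using \<rho>_roots
  proof eventually_elim
    case (elim \<tau>)
    show ?case
    proof
      assume in_range: "xh $ j + \<tau> \<in> {0..1}"
      have bc: "b \<le> c" and ih_le': "ih \<le> ?k"
        using b c(1) ih_le by auto
      note eig = eigval_split[OF elim(5) ih_le', of c b, OF bspec[OF elim(1)] bspec[OF elim(2)] bc]
      have tail: "tail_avg ?k s (eigval (X \<tau>)) ih = avg \<tau>"
        unfolding tail_avg_def avg_def using eig(2)[of "\<lambda>x. x"] by simp
      have psd: "0 \<le> x \<bullet> (X \<tau> *v x)" for x
        using Fmap_psd[of "\<chi> i. if i = j then xh $ j + \<tau> else xh $ i" x F] range in_range
        by (simp add: Fmap_update X_def v_def)
      have "is_iota ?k s (eigval (X \<tau>)) ih"
        unfolding is_iota_def tail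
        using ih_less ih_le elim(3,4) eig(3)[of ih] eig(4)[of "ih + 1"] by fastforce
      moreover have "\<exists>!i. is_iota ?k s (eigval (X \<tau>)) i"
        by (rule is_iota_ex1[OF s_pos s_le])
          (use eig(5,6) char_polynomial_root_nonneg[OF psd] in blast)+
      ultimately have "iota ?k s (eigval (X \<tau>)) = ih"
        unfolding iota_def by (rule the1_equality[rotated])
      then show "Gam s (X \<tau>) = (\<Sum>l = 1..ih. ln (\<rho> l \<tau>)) + (real s - real ih) * ln (avg \<tau>)"
        by (simp only: Gam_def phi_def Let_def tail eig(1))
    qed
  qed

  \<comment> \<open>This is the derivative in terms of the branch speeds \<open>d\<close>, which
    individually may differ from the squares \<open>(v \<bullet> uh l)\<^sup>2\<close>.\<close>
  define D where "D = (\<Sum>l = 1..ih. d l / lamh l) + (\<Sum>l = ih + 1..?k. d l / T)"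
  have "((\<lambda>\<tau>. (\<Sum>l = 1..ih. ln (\<rho> l \<tau>)) + (real s - real ih) * ln (avg \<tau>)) has_real_derivative
      (\<Sum>l = 1..ih. inverse (\<rho> l 0) * d l) +
      (real s - real ih) * (inverse (avg 0) * ((\<Sum>l = ih + 1..?k. d l) / (real s - real ih)))) (at 0)"
  proof (intro DERIV_add DERIV_sum DERIV_cmult)
    fix l assume l: "l \<in> {1..ih}"
    then have "l \<in> ?K" "0 < \<rho> l 0"
      using ih_le lamh_hi[OF l] T_pos \<rho>0[of l] by auto
    then show "((\<lambda>\<tau>. ln (\<rho> l \<tau>)) has_real_derivative inverse (\<rho> l 0) * d l) (at 0)"
      by (intro DERIV_chain2[OF DERIV_ln] \<rho>')
  next
    show "((\<lambda>\<tau>. ln (avg \<tau>)) has_real_derivative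
        inverse (avg 0) * ((\<Sum>l = ih + 1..?k. d l) / (real s - real ih))) (at 0)"
      using T_pos by (intro DERIV_chain2[OF DERIV_ln] avg') (simp add: avg_0)
  qed
  also have "(\<Sum>l = 1..ih. inverse (\<rho> l 0) * d l) = (\<Sum>l = 1..ih. d l / lamh l)"
    using \<rho>0 ih_le by (intro sum.cong) (auto simp: field_simps)
  also have "(real s - real ih) * (inverse (avg 0) * ((\<Sum>l = ih + 1..?k. d l) / (real s - real ih))) =
      (\<Sum>l = ih + 1..?k. d l / T)"
    using ih_less T_pos by (simp add: avg_0 divide_simps flip: sum_divide_distrib)
  finally have deriv: "((\<lambda>\<tau>. (\<Sum>l = 1..ih. ln (\<rho> l \<tau>)) + (real s - real ih) * ln (avg \<tau>))
      has_real_derivative D) (at 0)"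
    by (simp only: D_def)

  have K_split: "sum f ?K = sum f {1..ih} + sum f {ih + 1..?k}" for f :: "nat \<Rightarrow> real"
    using sum.ub_add_nat[of 1 ih f "?k - ih"] ih_le by simp
  \<comment> \<open>\<open>d_sum\<close> needs coefficients that depend on the eigenvalue alone. As
    \<open>T\<close> separates the two groups, comparison with \<open>T\<close> recovers which
    coefficient belongs to \<open>l\<close>.\<close>
  define g where "g x = (if T < x then 1 / x else 1 / T)" for x
  have weighted: "(\<Sum>l\<in>?K. g (lamh l) * f l) = (\<Sum>l = 1..ih. f l / lamh l) + (\<Sum>l = ih + 1..?k. f l / T)"
    for f :: "nat \<Rightarrow> real"
    unfolding K_split g_def using lamh_hi lamh_lo T_gt
    by (intro arg_cong2[where f = "(+)"] sum.cong) (fastforce simp: not_less)+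
  have "D = (\<Sum>l = 1..ih. (v \<bullet> uh l)\<^sup>2 / lamh l) + (\<Sum>l = ih + 1..?k. (v \<bullet> uh l)\<^sup>2 / T)"
    using d_sum[of g] by (simp only: weighted D_def)
  also have "\<dots> = (\<Sum>l = 1..ih. (1 / lamh l) * (v \<bullet> uh l)\<^sup>2) +
      (\<Sum>l = ih + 1..?k. ((real s - real ih) / (\<Sum>i = ih + 1..?k. lamh i)) * (v \<bullet> uh l)\<^sup>2)"
    by (simp add: T_def tail_avg_def mult.commute)
  finally have D: "D = \<dots>" .

  have shift: "((\<lambda>t. t - xh $ j) has_real_derivative 1) (at (xh $ j) within {0..1})"
    by (auto intro!: derivative_eq_intros)
  have "((\<lambda>t. (\<Sum>l = 1..ih. ln (\<rho> l (t - xh $ j))) + (real s - real ih) * ln (avg (t - xh $ j)))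
      has_real_derivative D) (at (xh $ j) within {0..1})"
    using DERIV_chain2[OF _ shift] deriv by fastforce
  \<comment> \<open>The filter \<open>nhds\<close> includes the base point, where the two functions
    must also agree. Equality inside the unit interval suffices for the derivative within it, which
    is one-sided at an end point.\<close>
  moreover have "\<forall>\<^sub>F t in nhds (xh $ j). t \<in> {0..1} \<longrightarrow>
      Gam s (X (t - xh $ j)) =
      (\<Sum>l = 1..ih. ln (\<rho> l (t - xh $ j))) + (real s - real ih) * ln (avg (t - xh $ j))"
  proof -
    have "((\<lambda>t. t - xh $ j) \<longlongrightarrow> 0) (nhds (xh $ j))"
      using isCont_tendsto_nhds[where f = "\<lambda>t. t - xh $ j" and a = "xh $ j"] by simp
    from filterlim_iff[THEN iffD1, OF this, rule_format, OF Gam_eq] show ?thesis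
      by simp
  qed
  ultimately have "((\<lambda>t. Gam s (X (t - xh $ j))) has_real_derivative D) (at (xh $ j) within {0..1})"
    using range by (subst has_field_derivative_cong_ev[OF refl _ refl refl]) auto
  then show ?thesis
    unfolding D by (simp only: X_def v_def Fmap_update)
qed

end
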